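(* Let $n\ge1$, let $v\in Z_4^n$ be a column vector, and for $i=0,1,2,3$ let $f_i$ be the number of entries of $v$ equal to $i$. Let $D$ be the two-level $2^{2n}\times(2n+2)$ design generated by $G=(v,I_n)$. (a) If $f_2>0$, the projectivity of $D$ is $2(f_1+f_3)+1$. (b) If $f_2=0$ and $f_1+f_3>0$, the projectivity of $D$ is $2(f_1+f_3)-1$.
   Context: $Z_4=\{0,1,2,3\}$ is the ring of integers modulo 4. Design generated by $G=(v,I_n)$: let $C$ be the $2^{2n}\times(n+1)$ matrix whose rows are all linear combinations $uG$, $u\in Z_4^n$. Replace each entry of $C$ by a pair of $\pm1$ symbols via the Gray map $0\mapsto(1,1)$, $1\mapsto(1,-1)$, $2\mapsto(-1,-1)$, $3\mapsto(-1,1)$, so that column $j$ of $C$ becomes columns $2j-1,2j$. The result $D$ is a $2^{2n}\times(2n+2)$ matrix with entries $\pm1$ (a two-level design; rows are runs, columns are factors). A two-level design has projectivity $p$ if for every set of $p$ columns, the projection of the design onto these columns contains all $2^p$ level combinations in $\{\pm1\}^p$ (possibly with repetitions). "The projectivity of $D$" is the largest such $p$. *)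

theory Defs
  imports "Jordan_Normal_Form.Matrix" "HOL-Library.Numeral_Type"
begin

text \<open>
  The ring of integers modulo 4 is the numeral type \<open>4\<close>, whose arithmetic is modulo 4 and whose
  elements are \<open>0, 1, 2, 3\<close>. Rows and columns of matrices are indexed from \<open>0\<close>.
\<close>

type_synonym Z4 = 4

definition gray :: "Z4 \<Rightarrow> int \<times> int" where
  "gray a = (if a = 0 then (1, 1) else if a = 1 then (1, -1)
             else if a = 2 then (-1, -1) else (-1, 1))"

text \<open>Column \<open>j\<close> of \<open>C\<close> becomes the columns \<open>2 * j\<close> and \<open>2 * j + 1\<close>.\<close>

definition gray_mat :: "Z4 mat \<Rightarrow> int mat" where
  "gray_mat C = mat (dim_row C) (2 * dim_col C)
     (\<lambda>(i, j). (if even j then fst else snd) (gray (C $$ (i, j div 2))))"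

text \<open>
  The rows of \<open>U\<close> enumerate all coefficient vectors \<open>u\<close>, each exactly once, so the rows of \<open>U * G\<close>
  are all the linear combinations \<open>u G\<close>. The order of the runs is left open, which makes this
  a relation rather than a function.
\<close>

definition design_generated_by :: "Z4 mat \<Rightarrow> int mat \<Rightarrow> bool" where
  "design_generated_by G D \<longleftrightarrow>
     (\<exists>U. U \<in> carrier_mat (2 ^ (2 * dim_row G)) (dim_row G) \<and>
          bij_betw (row U) {..<dim_row U} (carrier_vec (dim_row G)) \<and>
          D = gray_mat (U * G))"

text \<open>The matrix \<open>(v, I_n)\<close>, where \<open>n\<close> is the dimension of \<open>v\<close>.\<close>

definition generator_mat :: "Z4 vec \<Rightarrow> Z4 mat" where
  "generator_mat v = mat_of_cols (dim_vec v) (v # cols (1\<^sub>m (dim_vec v)))"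

definition entry_freq :: "Z4 vec \<Rightarrow> Z4 \<Rightarrow> nat" where
  "entry_freq v a = card {k. k < dim_vec v \<and> v $ k = a}"

definition has_projectivity :: "int mat \<Rightarrow> nat \<Rightarrow> bool" where
  "has_projectivity D p \<longleftrightarrow>
     (\<forall>S. S \<subseteq> {..<dim_col D} \<and> card S = p \<longrightarrow>
        (\<forall>e. (\<forall>j\<in>S. e j \<in> {1, -1}) \<longrightarrow>
           (\<exists>i<dim_row D. \<forall>j\<in>S. D $$ (i, j) = e j)))"

text \<open>
  The bound by the number of columns is needed because \<open>has_projectivity D p\<close> holds vacuously for
  larger \<open>p\<close>.
\<close>

definition projectivity :: "int mat \<Rightarrow> nat" where
  "projectivity D = Max {p. p \<le> dim_col D \<and> has_projectivity D p}"

lemma Z4_exhaust: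
  fixes a :: Z4
  shows "a = 0 \<or> a = 1 \<or> a = 2 \<or> a = 3"
proof -
  have "card {0, 1, 2, 3 :: Z4} = CARD(Z4)"
    by simp
  then have "{0, 1, 2, 3 :: Z4} = UNIV"
    by (intro card_subset_eq) simp_all
  then show ?thesis
    by blast
qed

lemma bij_betw_list_of_vec:
  "bij_betw list_of_vec (carrier_vec n :: 'a vec set) {xs. length xs = n}"
proof (rule bij_betw_byWitness[where f' = vec_of_list])
  show "\<forall>v\<in>carrier_vec n. vec_of_list (list_of_vec v) = (v :: 'a vec)"
    by (simp add: vec_list)
  show "\<forall>xs\<in>{xs. length xs = n}. list_of_vec (vec_of_list xs) = (xs :: 'a list)"
    by (simp add: list_vec)
  show "list_of_vec ` (carrier_vec n :: 'a vec set) \<subseteq> {xs. length xs = n}"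
    by (intro image_subsetI) simp
  show "vec_of_list ` {xs :: 'a list. length xs = n} \<subseteq> carrier_vec n"
    by (intro image_subsetI carrier_vecI) simp
qed

lemma card_carrier_vec_Z4:
  "finite (carrier_vec n :: Z4 vec set)" "card (carrier_vec n :: Z4 vec set) = 2 ^ (2 * n)"
proof -
  have fin: "finite {xs :: Z4 list. length xs = n}"
    using finite_lists_length_eq[of "UNIV :: Z4 set" n] by simp
  show "finite (carrier_vec n :: Z4 vec set)"
    using bij_betw_finite[OF bij_betw_list_of_vec[of n, where ?'a = Z4]] fin by simp
  show "card (carrier_vec n :: Z4 vec set) = 2 ^ (2 * n)"
    using bij_betw_same_card[OF bij_betw_list_of_vec[of n, where ?'a = Z4]]
      card_lists_length_eq[of "UNIV :: Z4 set" n] by (simp add: power_mult)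
qed

lemma design_generated_by_exists: "\<exists>D. design_generated_by G D"
proof -
  let ?n = "dim_row G"
  obtain h where h: "bij_betw h {0..<2 ^ (2 * ?n) :: nat} (carrier_vec ?n :: Z4 vec set)"
    using ex_bij_betw_nat_finite[OF card_carrier_vec_Z4(1)[of ?n]]
    unfolding card_carrier_vec_Z4(2) by blast
  define U where "U = mat (2 ^ (2 * ?n)) ?n (\<lambda>(i, j). h i $ j)"
  have row: "row U i = h i" if "i \<in> {..<dim_row U}" for i
  proof (rule eq_vecI)
    have "h i \<in> carrier_vec ?n"
      using that bij_betwE[OF h] by (simp add: U_def)
    then show "dim_vec (row U i) = dim_vec (h i)"
      by (simp add: U_def)
    show "row U i $ j = h i $ j" if "j < dim_vec (h i)" for j
      using that \<open>i \<in> {..<dim_row U}\<close> \<open>h i \<in> carrier_vec ?n\<close> by (simp add: U_def)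
  qed
  have "bij_betw h {..<dim_row U} (carrier_vec ?n)"
    using h by (simp add: U_def lessThan_atLeast0)
  then have "bij_betw (row U) {..<dim_row U} (carrier_vec ?n)"
    using bij_betw_cong[of "{..<dim_row U}" "row U" h, OF row] by blast
  moreover have "U \<in> carrier_mat (2 ^ (2 * ?n)) ?n"
    by (simp add: U_def)
  ultimately show ?thesis
    unfolding design_generated_by_def by blast
qed

end

theory Submission
  imports Defs "HOL-Library.Infinite_Set"
begin

text \<open>
  Prescribing one of the two signs of \<open>gray a\<close> leaves two cyclically adjacent values for \<open>a\<close>, and
  multiplication by a unit of the ring keeps them adjacent. Hence, if the columns \<open>S\<close> leave \<open>M\<close>
  signs free at the coordinates where \<open>v\<close> is odd, then \<open>u \<bullet> v\<close> still takes \<open>M + 1\<close> consecutive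
  values; a coordinate with \<open>v $ k = 2\<close> and a free sign adds a shift by \<open>2\<close>. Counting the columns of
  \<open>S\<close> shows that these values suffice to realise the signs prescribed on the first two columns.

  Conversely, prescribing \<open>u $ k = 0\<close> at all odd coordinates makes \<open>u \<bullet> v\<close> even, so
  \<open>u \<bullet> v = 3\<close> is impossible. If \<open>v\<close> has no entry \<open>2\<close>, one may even leave a suitable one of these
  signs free: then \<open>u \<bullet> v \<in> {0, 1}\<close>, so the first sign of \<open>gray (u \<bullet> v)\<close> alone cannot be \<open>-1\<close>.
\<close>

section \<open>Gray signs at a single coordinate and sums of intervals\<close>

definition col_count :: "nat set \<Rightarrow> nat \<Rightarrow> nat" where
  "col_count S j = (if 2 * j \<in> S then 1 else 0) + (if 2 * j + 1 \<in> S then 1 else 0)"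

definition gray_matches :: "nat set \<Rightarrow> (nat \<Rightarrow> int) \<Rightarrow> nat \<Rightarrow> Z4 \<Rightarrow> bool" where
  "gray_matches S e j a \<longleftrightarrow>
     (2 * j \<in> S \<longrightarrow> fst (gray a) = e (2 * j)) \<and> (2 * j + 1 \<in> S \<longrightarrow> snd (gray a) = e (2 * j + 1))"

lemma col_count_le: "col_count S j \<le> 2"
  by (simp add: col_count_def)

lemma sum_col_count:
  assumes "S \<subseteq> {..<2 * N}"
  shows "(\<Sum>j<N. col_count S j) = card S"
  using assms
proof (induction N arbitrary: S)
  case 0
  then show ?case by simp
next
  case (Suc N)
  define T where "T = S \<inter> {..<2 * N}"
  have S: "S = T \<union> (S \<inter> {2 * N}) \<union> (S \<inter> {2 * N + 1})"
    using Suc.prems by (force simp: T_def)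
  have "card S = card T + card (S \<inter> {2 * N}) + card (S \<inter> {2 * N + 1})"
    by (subst S, (subst card_Un_disjoint; auto simp: T_def)+)
  also have "\<dots> = card T + col_count S N"
    by (simp add: col_count_def Int_insert_right)
  also have "card T = (\<Sum>j<N. col_count T j)"
    by (rule Suc.IH[symmetric]) (simp add: T_def)
  also have "\<dots> = (\<Sum>j<N. col_count S j)"
    by (intro sum.cong) (auto simp: T_def col_count_def)
  finally show ?case by simp
qed

definition is_odd :: "Z4 \<Rightarrow> bool" where
  "is_odd c \<longleftrightarrow> c = 1 \<or> c = 3"

text \<open>With 0, 1 or 2 signs prescribed, the admissible \<open>a\<close> are all four values,
  two adjacent ones, or a single one, so they always contain \<open>3 - col_count S j\<close>
  consecutive values. For no prescribed sign this understates the truth, but the bound is linear in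
  the number of prescribed columns and can be summed.\<close>

lemma gray_matches_times_interval:
  fixes c :: Z4
  assumes "\<forall>i\<in>S. e i \<in> {1, -1}"
  shows "\<exists>d. \<forall>r \<le> (if is_odd c then 2 - col_count S j else 0).
           \<exists>a. gray_matches S e j a \<and> c * a = d + of_nat r"
proof -
  have e0: "2 * j \<in> S \<Longrightarrow> e (2 * j) = 1 \<or> e (2 * j) = -1"
    and e1: "2 * j + 1 \<in> S \<Longrightarrow> e (2 * j + 1) = 1 \<or> e (2 * j + 1) = -1"
    using assms by auto
  \<comment> \<open>The Gray map is onto the four sign pairs, so every prescription can be
    met.\<close>
  have ex: "\<exists>a. gray_matches S e j a"
  proof -
    have "gray_matches S e j 0 \<or> gray_matches S e j 1 \<or> gray_matches S e j 2 \<or> gray_matches S e j 3"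
      using e0 e1 by (auto simp: gray_matches_def gray_def)
    then show ?thesis by blast
  qed
  consider "\<not> is_odd c \<or> col_count S j = 2" | "is_odd c" "col_count S j = 0"
    | "is_odd c" "col_count S j = 1"
    using col_count_le[of S j] by linarith
  then show ?thesis
  proof cases
    case 1
    then show ?thesis using ex by auto
  next
    case 2
    \<comment> \<open>An odd \<open>c\<close> is its own inverse, so \<open>c * of_nat r\<close> is
      the preimage of \<open>of_nat r\<close>.\<close>
    then have "c * c = 1"
      by (auto simp: is_odd_def)
    then have "c * (c * of_nat r) = 0 + of_nat r" for r
      by (simp flip: mult.assoc)
    moreover have "gray_matches S e j a" for a
      using 2 by (auto simp: gray_matches_def col_count_def split: if_splits)
    ultimately show ?thesis by blast
  next
    case 3
    have "\<exists>a. gray_matches S e j a \<and> gray_matches S e j (a + 1)"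
    proof -
      have "\<exists>a\<in>{0, 1, 2, 3}. gray_matches S e j a \<and> gray_matches S e j (a + 1)"
        using 3(2) e0 e1 by (auto simp: gray_matches_def gray_def col_count_def split: if_splits)
      then show ?thesis by blast
    qed
    then obtain a where a: "gray_matches S e j a" "gray_matches S e j (a + 1)"
      by blast
    have r: "r = 0 \<or> r = 1" if "r \<le> 2 - col_count S j" for r
      using that 3(2) by auto
    from 3(1) consider "c = 1" | "c = 3" by (auto simp: is_odd_def)
    then show ?thesis
    proof cases
      case 1
      show ?thesis
      proof (rule exI[of _ a], intro allI impI)
        fix r assume "r \<le> (if is_odd c then 2 - col_count S j else 0)"
        then have "r = 0 \<or> r = 1" using r 3(1) by simp
        then show "\<exists>b. gray_matches S e j b \<and> c * b = a + of_nat r"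
          using a 1 by auto
      qed
    next
      case 2
      \<comment> \<open>Multiplication by 3, that is by -1, reverses the pair \<open>a\<close>,
        \<open>a + 1\<close>, so the image interval starts at the image of
        \<open>a + 1\<close>.\<close>
      have eq: "c * a = 3 * (a + 1) + 1"
        using 2 by (simp add: distrib_left)
      show ?thesis
      proof (rule exI[of _ "3 * (a + 1)"], intro allI impI)
        fix r assume "r \<le> (if is_odd c then 2 - col_count S j else 0)"
        then have "r = 0 \<or> r = 1" using r 3(1) by simp
        then show "\<exists>b. gray_matches S e j b \<and> c * b = 3 * (a + 1) + of_nat r"
          using a 2 eq by (metis add_0_right of_nat_0 of_nat_1)
      qed
    qed
  qed
qed

text \<open>The coordinates are chosen independently, so the intervals add up elementwise: start
  points and lengths are both summed.\<close>

lemma gray_matches_sum_interval: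
  fixes c :: "nat \<Rightarrow> Z4"
  assumes e: "\<forall>i\<in>S. e i \<in> {1, -1}" and "finite K"
  shows "\<exists>d. \<forall>r \<le> (\<Sum>k\<in>K. if is_odd (c k) then 2 - col_count S (Suc k) else 0).
           \<exists>u. (\<forall>k\<in>K. gray_matches S e (Suc k) (u k)) \<and> (\<Sum>k\<in>K. c k * u k) = d + of_nat r"
  using assms(2)
proof induction
  case empty
  then show ?case by simp
next
  case (insert x K)
  let ?h = "\<lambda>k. if is_odd (c k) then 2 - col_count S (Suc k) else 0"
  obtain d where d: "\<And>r. r \<le> sum ?h K \<Longrightarrow>
      \<exists>u. (\<forall>k\<in>K. gray_matches S e (Suc k) (u k)) \<and> (\<Sum>k\<in>K. c k * u k) = d + of_nat r"
    using insert.IH by blast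
  obtain d' where d': "\<And>r. r \<le> ?h x \<Longrightarrow>
      \<exists>a. gray_matches S e (Suc x) a \<and> c x * a = d' + of_nat r"
    using gray_matches_times_interval[OF e, of "c x" "Suc x"] by blast
  show ?case
  proof (intro exI[of _ "d' + d"] allI impI)
    fix r assume "r \<le> sum ?h (insert x K)"
    then have "r \<le> ?h x + sum ?h K" using insert.hyps by simp
    \<comment> \<open>Greedy split: as much of \<open>r\<close> as possible is produced at
      \<open>x\<close>, the rest in \<open>K\<close>.\<close>
    then have "r = min r (?h x) + (r - ?h x)" "min r (?h x) \<le> ?h x" "r - ?h x \<le> sum ?h K"
      by linarith+
    then obtain r1 r2 where r: "r = r1 + r2" "r1 \<le> ?h x" "r2 \<le> sum ?h K"
      by blast
    obtain u where u: "\<forall>k\<in>K. gray_matches S e (Suc k) (u k)" "(\<Sum>k\<in>K. c k * u k) = d + of_nat r2"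
      using d[OF r(3)] by blast
    obtain a where a: "gray_matches S e (Suc x) a" "c x * a = d' + of_nat r1"
      using d'[OF r(2)] by blast
    have "(\<Sum>k\<in>K. c k * (u(x := a)) k) = (\<Sum>k\<in>K. c k * u k)"
      using insert.hyps by (intro sum.cong) auto
    then have "(\<Sum>k\<in>insert x K. c k * (u(x := a)) k) = d' + d + of_nat r"
      using insert.hyps a u r by (simp add: algebra_simps)
    moreover have "\<forall>k\<in>insert x K. gray_matches S e (Suc k) ((u(x := a)) k)"
      using u a by simp
    ultimately show "\<exists>u. (\<forall>k\<in>insert x K. gray_matches S e (Suc k) (u k)) \<and>
        (\<Sum>k\<in>insert x K. c k * u k) = d' + d + of_nat r"
      by blast
  qed
qed

text \<open>A free sign leaves admissible values of both parities, and changing the parity of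
  \<open>a\<close> changes \<open>2 * a\<close> by 2. This provides the shift at a coordinate where
  \<open>v\<close> has entry 2.\<close>

lemma gray_matches_toggle:
  assumes "gray_matches S e j a" "col_count S j < 2"
  shows "\<exists>b. gray_matches S e j b \<and> 2 * b = 2 * a + 2"
proof -
  have "\<exists>b\<in>{0, 1, 2, 3}. gray_matches S e j b \<and> 2 * b = 2 * a + 2"
    using assms Z4_exhaust[of a]
    by (auto simp: gray_matches_def gray_def col_count_def split: if_splits)
  then show ?thesis by blast
qed

text \<open>One prescribed sign rules out two consecutive values and two signs rule out three, so
  \<open>col_count S j + 2\<close> consecutive values always include an admissible one.\<close>

lemma gray_matches_in_interval:
  assumes e: "\<forall>i\<in>S. e i \<in> {1, -1}" and "col_count S j < M"
  shows "\<exists>r\<le>M. gray_matches S e j (d + of_nat r)"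
proof -
  have e0: "2 * j \<in> S \<Longrightarrow> e (2 * j) = 1 \<or> e (2 * j) = -1"
    and e1: "2 * j + 1 \<in> S \<Longrightarrow> e (2 * j + 1) = 1 \<or> e (2 * j + 1) = -1"
    using assms by auto
  have "\<exists>r\<in>{0, 1, 2, 3}. r \<le> col_count S j + 1 \<and> gray_matches S e j (d + of_nat r)"
    by (insert Z4_exhaust[of d] e0 e1; cases "2 * j \<in> S"; cases "2 * j + 1 \<in> S"; elim disjE)
      (simp_all add: gray_matches_def gray_def col_count_def, (elim disjE; simp)+)
  then obtain r where "r \<le> col_count S j + 1" "gray_matches S e j (d + of_nat r)"
    by blast
  with assms(2) show ?thesis
    by (intro exI[of _ r]) auto
qed

text \<open>If at most one sign is prescribed, the admissible values and their shifts by 2 cover the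
  whole ring, and \<open>r = 0\<close> works. If both are prescribed, they form a parity class,
  which any two consecutive values meet. The truncated \<open>col_count S j - 1\<close> covers all
  these cases.\<close>

lemma gray_matches_in_interval_shift:
  assumes e: "\<forall>i\<in>S. e i \<in> {1, -1}" and "col_count S j \<le> M + 1"
  shows "\<exists>r\<le>M. gray_matches S e j (d + of_nat r) \<or> gray_matches S e j (d + of_nat r + 2)"
proof -
  have e0: "2 * j \<in> S \<Longrightarrow> e (2 * j) = 1 \<or> e (2 * j) = -1"
    and e1: "2 * j + 1 \<in> S \<Longrightarrow> e (2 * j + 1) = 1 \<or> e (2 * j + 1) = -1"
    using assms by auto
  have "\<exists>r\<in>{0, 1}. r \<le> col_count S j - 1 \<and>
      (gray_matches S e j (d + of_nat r) \<or> gray_matches S e j (d + of_nat r + 2))"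
    by (insert Z4_exhaust[of d] e0 e1; cases "2 * j \<in> S"; cases "2 * j + 1 \<in> S"; elim disjE)
      (simp_all add: gray_matches_def gray_def col_count_def, (elim disjE; simp)+)
  then obtain r where "r \<le> col_count S j - 1"
      "gray_matches S e j (d + of_nat r) \<or> gray_matches S e j (d + of_nat r + 2)"
    by blast
  with assms(2) show ?thesis
    by (intro exI[of _ r]) auto
qed

section \<open>From runs of the design to coefficient functions\<close>

definition realizable :: "Z4 vec \<Rightarrow> nat set \<Rightarrow> (nat \<Rightarrow> int) \<Rightarrow> bool" where
  "realizable v S e \<longleftrightarrow>
     (\<exists>u. gray_matches S e 0 (\<Sum>k<dim_vec v. v $ k * u k) \<and>
          (\<forall>k<dim_vec v. gray_matches S e (Suc k) (u k)))"

lemma realizable_mono: "realizable v S e \<Longrightarrow> T \<subseteq> S \<Longrightarrow> realizable v T e"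
  unfolding realizable_def gray_matches_def by blast

lemma generator_mat_dim [simp]:
  "dim_row (generator_mat v) = dim_vec v" "dim_col (generator_mat v) = dim_vec v + 1"
  by (simp_all add: generator_mat_def)

lemma col_generator_mat_0: "col (generator_mat v) 0 = v"
  unfolding generator_mat_def by (subst col_mat_of_cols) auto

lemma col_generator_mat_Suc:
  "k < dim_vec v \<Longrightarrow> col (generator_mat v) (Suc k) = unit_vec (dim_vec v) k"
  unfolding generator_mat_def by (subst col_mat_of_cols) auto

lemma design_generated_by_entries:
  assumes "design_generated_by (generator_mat v) D"
  obtains U where "dim_row D = dim_row U" "dim_col D = 2 * Suc (dim_vec v)"
    "bij_betw (row U) {..<dim_row U} (carrier_vec (dim_vec v))"
    "\<And>i j. i < dim_row U \<Longrightarrow> j < dim_col D \<Longrightarrow> D $$ (i, j) =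
       (if even j then fst else snd) (gray (case j div 2 of
          0 \<Rightarrow> (\<Sum>k<dim_vec v. v $ k * row U i $ k) | Suc k \<Rightarrow> row U i $ k))"
proof -
  let ?n = "dim_vec v"
  from assms obtain U where U: "U \<in> carrier_mat (2 ^ (2 * ?n)) ?n"
      "bij_betw (row U) {..<dim_row U} (carrier_vec ?n)" "D = gray_mat (U * generator_mat v)"
    unfolding design_generated_by_def by auto
  have entry: "(U * generator_mat v) $$ (i, j) = (case j of
          0 \<Rightarrow> (\<Sum>k<?n. v $ k * row U i $ k) | Suc k \<Rightarrow> row U i $ k)"
    if "i < dim_row U" "j < Suc ?n" for i j
  proof (cases j)
    case 0
    with that show ?thesis
      by (simp add: col_generator_mat_0 scalar_prod_def lessThan_atLeast0 mult.commute)
  next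
    case (Suc k)
    with that U(1) show ?thesis
      by (simp add: col_generator_mat_Suc)
  qed
  show thesis
  proof (rule that[of U])
    show "dim_row D = dim_row U" "dim_col D = 2 * Suc ?n"
      by (simp_all add: U(3) gray_mat_def)
    show "bij_betw (row U) {..<dim_row U} (carrier_vec ?n)" by (rule U(2))
    fix i j assume "i < dim_row U" "j < dim_col D"
    moreover from this have "j div 2 < Suc ?n"
      by (auto simp: U(3) gray_mat_def)
    ultimately show "D $$ (i, j) = (if even j then fst else snd) (gray (case j div 2 of
          0 \<Rightarrow> (\<Sum>k<?n. v $ k * row U i $ k) | Suc k \<Rightarrow> row U i $ k))"
      using entry[of i "j div 2"] by (simp add: U(3) gray_mat_def)
  qed
qed

text \<open>Regroups single columns into Gray pairs: column \<open>j\<close> belongs to pair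
  \<open>j div 2\<close>, and its parity selects the sign.\<close>

lemma gray_matches_all_iff:
  assumes "S \<subseteq> {..<2 * N}"
  shows "(\<forall>j\<in>S. (if even j then fst else snd) (gray (f (j div 2))) = e j) \<longleftrightarrow>
         (\<forall>j<N. gray_matches S e j (f j))"
proof
  assume L: "\<forall>j\<in>S. (if even j then fst else snd) (gray (f (j div 2))) = e j"
  have "gray_matches S e j (f j)" for j
    using bspec[OF L, of "2 * j"] bspec[OF L, of "2 * j + 1"] by (simp add: gray_matches_def)
  then show "\<forall>j<N. gray_matches S e j (f j)" by blast
next
  assume R: "\<forall>j<N. gray_matches S e j (f j)"
  show "\<forall>j\<in>S. (if even j then fst else snd) (gray (f (j div 2))) = e j"
  proof
    fix j assume j: "j \<in> S"
    then have "gray_matches S e (j div 2) (f (j div 2))"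
      using R assms by auto
    then show "(if even j then fst else snd) (gray (f (j div 2))) = e j"
      using j by (cases "even j") (auto simp: gray_matches_def elim!: evenE oddE)
  qed
qed

lemma all_less_Suc_case_nat:
  "(\<forall>j<Suc n. P j (case j of 0 \<Rightarrow> x | Suc k \<Rightarrow> y k)) \<longleftrightarrow> P 0 x \<and> (\<forall>k<n. P (Suc k) (y k))"
  by (simp add: All_less_Suc2)

text \<open>The rows of \<open>U\<close> run through all of \<open>carrier_vec (dim_vec v)\<close>,
  so a quantifier over runs becomes one over coefficients \<open>u\<close>, and the order of the
  runs disappears.\<close>

lemma has_projectivity_iff_realizable:
  assumes "design_generated_by (generator_mat v) D"
  shows "has_projectivity D p \<longleftrightarrow>
    (\<forall>S. S \<subseteq> {..<2 * Suc (dim_vec v)} \<and> card S = p \<longrightarrow>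
      (\<forall>e. (\<forall>j\<in>S. e j \<in> {1, -1}) \<longrightarrow> realizable v S e))"
proof -
  let ?n = "dim_vec v"
  obtain U where U: "dim_row D = dim_row U" "dim_col D = 2 * Suc ?n"
    "bij_betw (row U) {..<dim_row U} (carrier_vec ?n)"
    "\<And>i j. i < dim_row U \<Longrightarrow> j < dim_col D \<Longrightarrow> D $$ (i, j) =
       (if even j then fst else snd) (gray (case j div 2 of
          0 \<Rightarrow> (\<Sum>k<?n. v $ k * row U i $ k) | Suc k \<Rightarrow> row U i $ k))"
    using design_generated_by_entries[OF assms] by blast
  have "(\<exists>i<dim_row D. \<forall>j\<in>S. D $$ (i, j) = e j) \<longleftrightarrow> realizable v S e"
    if S: "S \<subseteq> {..<2 * Suc ?n}" for S e
  proof -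
    define Q where "Q u \<longleftrightarrow> gray_matches S e 0 (\<Sum>k<?n. v $ k * u $ k) \<and>
        (\<forall>k<?n. gray_matches S e (Suc k) (u $ k))" for u
    have "(\<forall>j\<in>S. D $$ (i, j) = e j) \<longleftrightarrow> Q (row U i)" if "i < dim_row U" for i
    proof -
      have "(\<forall>j\<in>S. D $$ (i, j) = e j) \<longleftrightarrow>
          (\<forall>j\<in>S. (if even j then fst else snd) (gray (case j div 2 of
            0 \<Rightarrow> (\<Sum>k<?n. v $ k * row U i $ k) | Suc k \<Rightarrow> row U i $ k)) = e j)"
      proof (intro ball_cong refl)
        fix j assume "j \<in> S"
        then have "j < dim_col D" using S U(2) by auto
        then show "D $$ (i, j) = e j \<longleftrightarrow>
          (if even j then fst else snd) (gray (case j div 2 of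
            0 \<Rightarrow> (\<Sum>k<?n. v $ k * row U i $ k) | Suc k \<Rightarrow> row U i $ k)) = e j"
          by (simp only: U(4)[OF that])
      qed
      also have "\<dots> \<longleftrightarrow> Q (row U i)"
        unfolding gray_matches_all_iff[OF S] all_less_Suc_case_nat Q_def by (rule refl)
      finally show ?thesis .
    qed
    then have "(\<exists>i<dim_row D. \<forall>j\<in>S. D $$ (i, j) = e j) \<longleftrightarrow> (\<exists>i\<in>{..<dim_row U}. Q (row U i))"
      using U(1) by auto
    also have "\<dots> \<longleftrightarrow> (\<exists>u\<in>carrier_vec ?n. Q u)"
      unfolding bij_betw_imp_surj_on[OF U(3), symmetric] by (rule bex_simps(7)[symmetric])
    also have "\<dots> \<longleftrightarrow> realizable v S e"
    proof
      assume "\<exists>u\<in>carrier_vec ?n. Q u"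
      then show "realizable v S e" unfolding realizable_def Q_def by blast
    next
      assume "realizable v S e"
      then obtain u where "gray_matches S e 0 (\<Sum>k<?n. v $ k * u k)"
          "\<forall>k<?n. gray_matches S e (Suc k) (u k)"
        unfolding realizable_def by blast
      then have "Q (vec ?n u)" by (simp add: Q_def)
      then show "\<exists>u\<in>carrier_vec ?n. Q u" by (intro bexI[of _ "vec ?n u"]) simp_all
    qed
    finally show ?thesis .
  qed
  then show ?thesis
    unfolding has_projectivity_def U(2) by (intro iff_allI imp_cong refl) (elim conjE)
qed

text \<open>One bad set of size \<open>Suc p\<close> excludes every larger size too: a pattern that
  no run shows on \<open>T\<close> is shown on no superset of \<open>T\<close>. Having
  \<open>e\<close> take values 1 and -1 everywhere, not just on \<open>T\<close>, keeps it a legal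
  pattern on such supersets.\<close>

lemma projectivity_eqI:
  assumes D: "design_generated_by (generator_mat v) D"
    and p: "p \<le> 2 * Suc (dim_vec v)"
    and full: "\<And>S e. S \<subseteq> {..<2 * Suc (dim_vec v)} \<Longrightarrow> card S = p \<Longrightarrow>
      \<forall>j\<in>S. e j \<in> {1, -1} \<Longrightarrow> realizable v S e"
    and T: "T \<subseteq> {..<2 * Suc (dim_vec v)}" "card T = Suc p"
    and e: "\<And>j. e j \<in> {1, -1}" "\<not> realizable v T e"
  shows "projectivity D = p"
proof -
  have dim: "dim_col D = 2 * Suc (dim_vec v)"
    using design_generated_by_entries[OF D] by blast
  show ?thesis
    unfolding projectivity_def
  proof (rule Max_eqI)
    show "p \<in> {p. p \<le> dim_col D \<and> has_projectivity D p}"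
      using p full by (simp add: dim has_projectivity_iff_realizable[OF D])
    show "finite {p. p \<le> dim_col D \<and> has_projectivity D p}" by simp
    fix q assume "q \<in> {p. p \<le> dim_col D \<and> has_projectivity D p}"
    then have q: "q \<le> 2 * Suc (dim_vec v)" "has_projectivity D q" by (auto simp: dim)
    show "q \<le> p"
    proof (rule ccontr)
      assume "\<not> q \<le> p"
      then have "card T \<le> q" using T by simp
      then obtain S where "T \<subseteq> S" "S \<subseteq> {..<2 * Suc (dim_vec v)}" "card S = q"
        using exists_subset_between[of T q "{..<2 * Suc (dim_vec v)}"] T q(1) by auto
      with q(2) e(1) have "realizable v S e"
        unfolding has_projectivity_iff_realizable[OF D] by blast
      with \<open>T \<subseteq> S\<close> e(2) show False using realizable_mono by blast
    qed
  qed
qed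

section \<open>Counting free signs, and sufficient conditions for realizability\<close>

definition odd_positions :: "Z4 vec \<Rightarrow> nat set" where
  "odd_positions v = {k. k < dim_vec v \<and> is_odd (v $ k)}"

lemma finite_odd_positions [simp]: "finite (odd_positions v)"
  by (simp add: odd_positions_def)

lemma card_odd_positions: "card (odd_positions v) = entry_freq v 1 + entry_freq v 3"
proof -
  have "odd_positions v = {k. k < dim_vec v \<and> v $ k = 1} \<union> {k. k < dim_vec v \<and> v $ k = 3}"
    by (auto simp: odd_positions_def is_odd_def)
  then show ?thesis
    unfolding entry_freq_def by (simp add: card_Un_disjoint disjoint_iff)
qed

text \<open>This is the number of free signs at odd coordinates; by \<open>col_count_le\<close> the
  subtraction never truncates.\<close>

definition free_count :: "Z4 vec \<Rightarrow> nat set \<Rightarrow> nat" where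
  "free_count v S = (\<Sum>k\<in>odd_positions v. 2 - col_count S (Suc k))"

text \<open>Each odd position owns two columns, each free or in \<open>S\<close>; the remaining
  columns of \<open>S\<close> lie in the first pair or at even positions. The additive form avoids
  subtraction of naturals.\<close>

lemma free_count_card:
  assumes "S \<subseteq> {..<2 * Suc (dim_vec v)}"
  shows "free_count v S + card S = 2 * card (odd_positions v) + col_count S 0
           + (\<Sum>k\<in>{..<dim_vec v} - odd_positions v. col_count S (Suc k))"
proof -
  have "card S = col_count S 0 + (\<Sum>k<dim_vec v. col_count S (Suc k))"
    using sum_col_count[OF assms] by (simp add: sum.lessThan_Suc_shift del: sum.lessThan_Suc)
  also have "(\<Sum>k<dim_vec v. col_count S (Suc k)) =
      (\<Sum>k\<in>{..<dim_vec v} - odd_positions v. col_count S (Suc k))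
        + (\<Sum>k\<in>odd_positions v. col_count S (Suc k))"
    by (rule sum.subset_diff) (auto simp: odd_positions_def)
  finally have "card S = col_count S 0 + \<dots>" .
  moreover have "free_count v S + (\<Sum>k\<in>odd_positions v. col_count S (Suc k)) =
      (\<Sum>k\<in>odd_positions v. 2)"
    unfolding free_count_def sum.distrib[symmetric] by (intro sum.cong) (simp_all add: col_count_le)
  ultimately show ?thesis by simp
qed

lemma free_count_interval:
  assumes "\<forall>j\<in>S. e j \<in> {1, -1}"
  obtains d where "\<And>r. r \<le> free_count v S \<Longrightarrow>
    \<exists>u. (\<forall>k<dim_vec v. gray_matches S e (Suc k) (u k)) \<and> (\<Sum>k<dim_vec v. v $ k * u k) = d + of_nat r"
proof -
  have "(\<Sum>k<dim_vec v. if is_odd (v $ k) then 2 - col_count S (Suc k) else 0) = free_count v S"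
    unfolding free_count_def odd_positions_def by (intro sum.mono_neutral_cong_right) auto
  then obtain d where "\<forall>r \<le> free_count v S.
    \<exists>u. (\<forall>k<dim_vec v. gray_matches S e (Suc k) (u k)) \<and> (\<Sum>k<dim_vec v. v $ k * u k) = d + of_nat r"
    using gray_matches_sum_interval[OF assms finite_lessThan, of "\<lambda>k. v $ k" "dim_vec v"]
    unfolding Ball_def lessThan_iff by auto
  then show thesis
    by (intro that[of d]) blast
qed

lemma realizable_if_free:
  assumes e: "\<forall>j\<in>S. e j \<in> {1, -1}" and "col_count S 0 < free_count v S"
  shows "realizable v S e"
proof -
  obtain d where d: "\<And>r. r \<le> free_count v S \<Longrightarrow>
    \<exists>u. (\<forall>k<dim_vec v. gray_matches S e (Suc k) (u k)) \<and> (\<Sum>k<dim_vec v. v $ k * u k) = d + of_nat r"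
    using free_count_interval[OF e] by blast
  obtain r where "r \<le> free_count v S" "gray_matches S e 0 (d + of_nat r)"
    using gray_matches_in_interval[OF assms] by blast
  with d[of r] show ?thesis
    unfolding realizable_def by metis
qed

text \<open>The shift by 2 available at \<open>k\<close> permits a \<open>free_count\<close> smaller
  by two than in \<open>realizable_if_free\<close>.\<close>

lemma realizable_if_free_two:
  assumes e: "\<forall>j\<in>S. e j \<in> {1, -1}" and c: "col_count S 0 \<le> free_count v S + 1"
    and k: "k < dim_vec v" "v $ k = 2" "col_count S (Suc k) < 2"
  shows "realizable v S e"
proof -
  obtain d where d: "\<And>r. r \<le> free_count v S \<Longrightarrow>
    \<exists>u. (\<forall>k<dim_vec v. gray_matches S e (Suc k) (u k)) \<and> (\<Sum>k<dim_vec v. v $ k * u k) = d + of_nat r"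
    using free_count_interval[OF e] by blast
  obtain r where r: "r \<le> free_count v S"
    "gray_matches S e 0 (d + of_nat r) \<or> gray_matches S e 0 (d + of_nat r + 2)"
    using gray_matches_in_interval_shift[OF e c] by blast
  obtain u where u: "\<forall>k<dim_vec v. gray_matches S e (Suc k) (u k)"
      "(\<Sum>k<dim_vec v. v $ k * u k) = d + of_nat r"
    using d[OF r(1)] by blast
  obtain b where b: "gray_matches S e (Suc k) b" "2 * b = 2 * u k + 2"
    using gray_matches_toggle k u(1) by blast
  \<comment> \<open>Replacing \<open>u k\<close> by \<open>b\<close> moves the sum by exactly 2,
    since \<open>v $ k = 2\<close>; the other terms stay.\<close>
  have "(\<Sum>i<dim_vec v. v $ i * (u(k := b)) i) =
      v $ k * b + (\<Sum>i\<in>{..<dim_vec v} - {k}. v $ i * u i)"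
    using k(1) by (subst sum.remove[of _ k]) auto
  also have "\<dots> = (\<Sum>i<dim_vec v. v $ i * u i) + 2"
    using k(1) b(2) by (subst (2) sum.remove[of _ k]) (auto simp: k(2))
  finally have "(\<Sum>i<dim_vec v. v $ i * (u(k := b)) i) = d + of_nat r + 2"
    using u(2) by simp
  moreover have "\<forall>i<dim_vec v. gray_matches S e (Suc i) ((u(k := b)) i)"
    using u(1) b(1) by simp
  ultimately show ?thesis
    using r(2) u unfolding realizable_def by metis
qed

section \<open>Sign patterns that no run shows\<close>

definition columns_of :: "nat set \<Rightarrow> nat set" where
  "columns_of J = {i. i div 2 \<in> J}"

lemma columns_of_subset: "J \<subseteq> {..<N} \<Longrightarrow> columns_of J \<subseteq> {..<2 * N}"
  by (auto simp: columns_of_def)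

lemma finite_columns_of: "finite J \<Longrightarrow> finite (columns_of J)"
  by (metis columns_of_subset finite_nat_iff_bounded)

lemma card_columns_of:
  assumes "finite J"
  shows "card (columns_of J) = 2 * card J"
proof -
  obtain N where N: "J \<subseteq> {..<N}" using assms finite_nat_iff_bounded by blast
  have "card (columns_of J) = (\<Sum>j<N. col_count (columns_of J) j)"
    using sum_col_count[OF columns_of_subset[OF N]] by simp
  also have "\<dots> = (\<Sum>j\<in>J. 2)"
    using N by (intro sum.mono_neutral_cong_right) (auto simp: col_count_def columns_of_def)
  finally show ?thesis by simp
qed

lemma not_odd_cases: "\<not> is_odd c \<Longrightarrow> c = 0 \<or> c = 2"
  using Z4_exhaust[of c] by (auto simp: is_odd_def)

text \<open>One pattern serves both obstructions. On full pairs it demands the value 3 in pair 0 and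
  0 in every other pair; column 0 alone demands 2 or 3.\<close>

definition first_negative :: "nat \<Rightarrow> int" where
  "first_negative j = (if j = 0 then -1 else 1)"

lemma not_realizable_columns_of_odd:
  "\<not> realizable v (columns_of (insert 0 (Suc ` odd_positions v))) first_negative"
    (is "\<not> realizable v ?S first_negative")
proof
  assume "realizable v ?S first_negative"
  then obtain u where u: "gray_matches ?S first_negative 0 (\<Sum>k<dim_vec v. v $ k * u k)"
      "\<And>k. k < dim_vec v \<Longrightarrow> gray_matches ?S first_negative (Suc k) (u k)"
    unfolding realizable_def by blast
  \<comment> \<open>Evenness modulo 4 is expressed by the vanishing of the double.\<close>
  have "2 * (v $ k * u k) = 0" if k: "k < dim_vec v" for k
  proof (cases "is_odd (v $ k)")
    case True
    then have "k \<in> odd_positions v" using k by (simp add: odd_positions_def)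
    then have "u k = 0"
      using u(2)[OF k] Z4_exhaust[of "u k"]
      by (auto simp: gray_matches_def columns_of_def first_negative_def gray_def)
    then show ?thesis by simp
  next
    case False
    then have "2 * (v $ k) = 0" using not_odd_cases by fastforce
    then show ?thesis by (simp flip: mult.assoc)
  qed
  then have "2 * (\<Sum>k<dim_vec v. v $ k * u k) = 0"
    unfolding sum_distrib_left by (intro sum.neutral) auto
  moreover have "(\<Sum>k<dim_vec v. v $ k * u k) = 3"
    using u(1) Z4_exhaust[of "\<Sum>k<dim_vec v. v $ k * u k"]
    by (auto simp: gray_matches_def columns_of_def first_negative_def gray_def)
  ultimately show False by simp
qed

text \<open>Away from \<open>k0\<close> every term vanishes, because \<open>u k = 0\<close> or
  \<open>v $ k = 0\<close>. The column \<open>j0\<close> is chosen to fit \<open>v $ k0\<close>: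
  entry 1 with a positive first sign gives \<open>u k0\<close> in {0, 1}, entry 3 with a positive
  second sign gives \<open>u k0\<close> in {0, 3}, and both times the product is 0 or 1.\<close>

lemma not_realizable_if_no_two:
  assumes no2: "\<And>k. k < dim_vec v \<Longrightarrow> v $ k \<noteq> 2" and k0: "k0 \<in> odd_positions v"
  defines "j0 \<equiv> (if v $ k0 = 1 then 2 * Suc k0 else 2 * Suc k0 + 1)"
  shows "\<not> realizable v (insert 0 (insert j0 (columns_of (Suc ` (odd_positions v - {k0})))))
     first_negative" (is "\<not> realizable v ?S first_negative")
proof
  assume "realizable v ?S first_negative"
  then obtain u where u: "gray_matches ?S first_negative 0 (\<Sum>k<dim_vec v. v $ k * u k)"
      "\<And>k. k < dim_vec v \<Longrightarrow> gray_matches ?S first_negative (Suc k) (u k)"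
    unfolding realizable_def by blast
  have k0': "k0 < dim_vec v" "v $ k0 = 1 \<or> v $ k0 = 3"
    using k0 by (auto simp: odd_positions_def is_odd_def)
  have "v $ k * u k = 0" if k: "k < dim_vec v" "k \<noteq> k0" for k
  proof (cases "is_odd (v $ k)")
    case True
    then have "k \<in> odd_positions v - {k0}" using k by (simp add: odd_positions_def)
    then have "u k = 0"
      using u(2)[OF k(1)] Z4_exhaust[of "u k"]
      by (auto simp: gray_matches_def columns_of_def first_negative_def gray_def)
    then show ?thesis by simp
  next
    case False
    then show ?thesis using not_odd_cases[OF False] no2[OF k(1)] by simp
  qed
  then have "(\<Sum>k<dim_vec v. v $ k * u k) = v $ k0 * u k0"
    using k0'(1) by (subst sum.remove[of _ k0]) auto
  moreover have "v $ k0 * u k0 = 0 \<or> v $ k0 * u k0 = 1"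
    using u(2)[OF k0'(1)] k0'(2) Z4_exhaust[of "u k0"]
    by (auto simp: gray_matches_def columns_of_def first_negative_def gray_def j0_def)
  ultimately show False
    using u(1) by (auto simp: gray_matches_def first_negative_def gray_def)
qed

section \<open>The two values of the projectivity\<close>

lemma projectivity_if_two:
  assumes D: "design_generated_by (generator_mat v) D" and k: "k < dim_vec v" "v $ k = 2"
  shows "projectivity D = 2 * card (odd_positions v) + 1"
proof (rule projectivity_eqI[OF D])
  let ?T = "columns_of (insert 0 (Suc ` odd_positions v))"
  have k_even: "k \<in> {..<dim_vec v} - odd_positions v"
    using k by (simp add: odd_positions_def is_odd_def)
  have "odd_positions v \<subseteq> {..<dim_vec v}" by (auto simp: odd_positions_def)
  then have "card (odd_positions v) \<le> dim_vec v"
    using card_mono[of "{..<dim_vec v}"] by auto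
  then show "2 * card (odd_positions v) + 1 \<le> 2 * Suc (dim_vec v)" by simp
  show "?T \<subseteq> {..<2 * Suc (dim_vec v)}"
    by (intro columns_of_subset) (auto simp: odd_positions_def)
  show "card ?T = Suc (2 * card (odd_positions v) + 1)"
    by (simp add: card_columns_of card_image)
  show "\<not> realizable v ?T first_negative" by (rule not_realizable_columns_of_odd)
  show "first_negative j \<in> {1, -1}" for j by (simp add: first_negative_def)
  fix S and e :: "nat \<Rightarrow> int"
  assume S: "S \<subseteq> {..<2 * Suc (dim_vec v)}" "card S = 2 * card (odd_positions v) + 1"
    and e: "\<forall>j\<in>S. e j \<in> {1, -1}"
  have count: "free_count v S + 1 = col_count S 0
      + (\<Sum>k\<in>{..<dim_vec v} - odd_positions v. col_count S (Suc k))"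
    using free_count_card[OF S(1)] S(2) by simp
  show "realizable v S e"
  \<comment> \<open>Either pair \<open>Suc k\<close> has a free sign and supplies the shift by 2, or
    both its columns lie in \<open>S\<close>. These two columns then sit at an even position, which
    by \<open>count\<close> leaves enough free signs elsewhere.\<close>
  proof (cases "col_count S (Suc k) < 2")
    case True
    then show ?thesis using realizable_if_free_two[OF e _ k] count by simp
  next
    case False
    then have "2 \<le> (\<Sum>k\<in>{..<dim_vec v} - odd_positions v. col_count S (Suc k))"
      using member_le_sum[OF k_even, of "\<lambda>k. col_count S (Suc k)"] by simp
    then show ?thesis using realizable_if_free[OF e] count by simp
  qed
qed

lemma projectivity_if_no_two:
  assumes D: "design_generated_by (generator_mat v) D"
    and no2: "\<And>k. k < dim_vec v \<Longrightarrow> v $ k \<noteq> 2" and k0: "k0 \<in> odd_positions v"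
  shows "projectivity D = 2 * card (odd_positions v) - 1"
proof (rule projectivity_eqI[OF D])
  let ?j0 = "if v $ k0 = 1 then 2 * Suc k0 else 2 * Suc k0 + 1"
  let ?J = "Suc ` (odd_positions v - {k0})"
  let ?T = "insert 0 (insert ?j0 (columns_of ?J))"
  have sub: "odd_positions v \<subseteq> {..<dim_vec v}" by (auto simp: odd_positions_def)
  \<comment> \<open>Positivity keeps \<open>2 * card (odd_positions v) - 1\<close> from
    truncating.\<close>
  have pos: "0 < card (odd_positions v)" using k0 card_gt_0_iff by fastforce
  have "card (odd_positions v) \<le> dim_vec v"
    using card_mono[OF _ sub] by simp
  then show "2 * card (odd_positions v) - 1 \<le> 2 * Suc (dim_vec v)" by simp
  have "columns_of ?J \<subseteq> {..<2 * Suc (dim_vec v)}"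
    by (intro columns_of_subset) (auto simp: odd_positions_def)
  then show "?T \<subseteq> {..<2 * Suc (dim_vec v)}"
    using k0 sub by auto
  \<comment> \<open>Column 0, the column \<open>?j0\<close> in the pair of \<open>k0\<close>, and
    the pairs of the other odd positions are disjoint.\<close>
  have "card ?T = 2 + card (columns_of ?J)"
  proof -
    have "0 \<notin> insert ?j0 (columns_of ?J)" "?j0 \<notin> columns_of ?J"
      by (auto simp: columns_of_def)
    then show ?thesis by (simp add: finite_columns_of)
  qed
  also have "\<dots> = Suc (2 * card (odd_positions v) - 1)"
    using pos k0 by (simp add: card_columns_of card_image)
  finally show "card ?T = Suc (2 * card (odd_positions v) - 1)" .
  show "\<not> realizable v ?T first_negative" using not_realizable_if_no_two[OF no2 k0] .
  show "first_negative j \<in> {1, -1}" for j by (simp add: first_negative_def)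
  fix S and e :: "nat \<Rightarrow> int"
  assume S: "S \<subseteq> {..<2 * Suc (dim_vec v)}" "card S = 2 * card (odd_positions v) - 1"
    and e: "\<forall>j\<in>S. e j \<in> {1, -1}"
  \<comment> \<open>With this size of \<open>S\<close>, \<open>free_count v S\<close> exceeds
    \<open>col_count S 0\<close> by 1 plus the number of columns of \<open>S\<close> at even
    positions.\<close>
  have "col_count S 0 < free_count v S"
    using free_count_card[OF S(1)] S(2) pos by linarith
  then show "realizable v S e" by (rule realizable_if_free[OF e])
qed

theorem theorem2:
  fixes n :: nat and v :: "Z4 vec" and D :: "int mat"
  assumes "n \<ge> 1"
    and "v \<in> carrier_vec n"
    and "design_generated_by (generator_mat v) D"
  shows "(entry_freq v 2 > 0 \<longrightarrow>
            projectivity D = 2 * (entry_freq v 1 + entry_freq v 3) + 1) \<and>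
         (entry_freq v 2 = 0 \<and> entry_freq v 1 + entry_freq v 3 > 0 \<longrightarrow>
            projectivity D = 2 * (entry_freq v 1 + entry_freq v 3) - 1)"
  unfolding card_odd_positions[symmetric]
proof (intro conjI impI)
  assume "entry_freq v 2 > 0"
  then obtain k where "k < dim_vec v" "v $ k = 2"
    unfolding entry_freq_def card_gt_0_iff by blast
  then show "projectivity D = 2 * card (odd_positions v) + 1"
    by (rule projectivity_if_two[OF assms(3)])
next
  assume *: "entry_freq v 2 = 0 \<and> card (odd_positions v) > 0"
  then obtain k0 where "k0 \<in> odd_positions v"
    unfolding card_gt_0_iff by blast
  moreover have "v $ k \<noteq> 2" if "k < dim_vec v" for k
    using * that by (auto simp: entry_freq_def)
  ultimately show "projectivity D = 2 * card (odd_positions v) - 1"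
    using projectivity_if_no_two[OF assms(3)] by blast
qed

end
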